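(* Let $G=C_n^r\oplus C_{kn}$ with $r\in\mathbb N_+$ and $n,k\in \mathbb N_{\ge 2}$, and suppose that $G$ is not a group of prime power order. Let $p$ be a prime divisor of $n$, let $k_1\in \mathbb N_{\geq 2}$ be a divisor of $k$ with $\gcd(p,k_1)=1$, and let $m\in\mathbb N$ be such that $kn=k_1m$. Then for any integer $t \in [1, k_1-1]$ we have $$\mathsf D(G) > \mathsf D^*(G)+\frac{t(p-1)}{\log p}\log r-t(p-1)(\log_p t +1)-tm.$$
   Context: $C_n$ denotes the cyclic group of order $n$, written additively; $\log$ is the natural logarithm and $\log_p$ the logarithm to base $p$. A sequence over a finite abelian group $G$ is a finite unordered sequence (multiset) of elements of $G$, repetition allowed; it is zero-sum if its terms sum to $0$. The Davenport constant $\mathsf D(G)$ is the smallest integer $d$ such that every sequence over $G$ of length at least $d$ (counted with multiplicity) has a nonempty zero-sum subsequence. If $G\cong C_{n_1}\oplus\dots\oplus C_{n_s}$ with $1<n_1\mid\dots\mid n_s$, then $\mathsf D^*(G)=1+\sum_{i=1}^s(n_i-1)$. *)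

theory Defs
  imports
    Complex_Main
    "HOL-Library.Multiset"
    "HOL-Algebra.FiniteProduct"
    "HOL-Algebra.Product_Groups"
    "HOL-Number_Theory.Prime_Powers"
begin

(* HOL-Algebra groups are written multiplicatively, so "sum" below is the group product
   and "zero" is the unit. Sequences over G are multisets supported in carrier G. *)

definition zero_sum :: "('a, 'b) monoid_scheme \<Rightarrow> 'a multiset \<Rightarrow> bool" where
  "zero_sum G S \<longleftrightarrow> finprod G (\<lambda>x. x [^]\<^bsub>G\<^esub> count S x) (set_mset S) = \<one>\<^bsub>G\<^esub>"

(* Only meaningful for finite abelian G, where such a d exists. A d \<le> 0 can never qualify
   (the empty sequence is a counterexample), so minimising over nat loses nothing. *)
definition davenport :: "('a, 'b) monoid_scheme \<Rightarrow> nat" where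
  "davenport G = (LEAST d. \<forall>S. set_mset S \<subseteq> carrier G \<and> size S \<ge> d \<longrightarrow>
                    (\<exists>T. T \<subseteq># S \<and> T \<noteq> {#} \<and> zero_sum G T))"

(* G is isomorphic to C_{n_1} + ... + C_{n_s} with 1 < n_1 | ... | n_s, for ns = [n_1, ..., n_s];
   the index set is finite, so the direct sum is the full product. *)
definition invariant_factors :: "('a, 'b) monoid_scheme \<Rightarrow> nat list \<Rightarrow> bool" where
  "invariant_factors G ns \<longleftrightarrow>
     (\<forall>n \<in> set ns. 1 < n) \<and> successively (dvd) ns \<and>
     G \<cong> product_group {..<length ns} (\<lambda>i. integer_mod_group (ns ! i))"

(* The value is unique because the list ns is (structure theorem for finite abelian groups). *)
definition davenport_star :: "('a, 'b) monoid_scheme \<Rightarrow> nat" where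
  "davenport_star G = (THE d. \<exists>ns. invariant_factors G ns \<and> d = 1 + (\<Sum>i<length ns. ns ! i - 1))"

end

theory Submission
  imports
    Defs
    "HOL-Number_Theory.Cong"
    "HOL-Algebra.Multiplicative_Group"
begin

text \<open>Let \<open>e\<^sub>a\<close> (\<open>a < r\<close>) and \<open>f\<close> be the standard generators of \<open>C\<^sub>n\<^sup>r \<oplus> C\<^sub>k\<^sub>n\<close>, let \<open>u = \<lfloor>log\<^sub>p (r / t)\<rfloor>\<close>
  (or \<open>0\<close> if \<open>r < t\<close>), and index \<open>t\<close> disjoint blocks of the \<open>e\<^sub>a\<close> by the nonzero vectors of
  \<open>F\<^sub>p\<^sup>u\<close>. For each block and each \<open>j < u\<close> let \<open>g\<^sub>j\<close> be \<open>- n / p\<close> times the sum of the \<open>v\<^sub>j e\<^sub>v\<close> over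
  the vectors \<open>v\<close> of that block. Take the \<open>g\<^sub>j\<close> with multiplicity \<open>p - 1\<close>, \<open>f\<close> with multiplicity
  \<open>(k\<^sub>1 - t) m - 1\<close>, and suitable translates \<open>e\<^sub>a + L\<^sub>a f\<close> with multiplicity \<open>n - 1\<close>.
  In a zero-sum subsequence that uses \<open>x\<^sub>j\<close> copies of \<open>g\<^sub>j\<close> in some block, \<open>e\<^sub>v\<close> must occur exactly
  \<open>(n / p) ((x \<bullet> v) mod p)\<close> times. The translations are chosen so that every block with \<open>x \<noteq> 0\<close>
  then contributes exactly \<open>m f\<close>. With \<open>s \<le> t\<close> such blocks and \<open>z\<close> copies of \<open>f\<close> the \<open>f\<close>-coordinate
  is \<open>s m + z < k\<^sub>1 m = k n\<close>, so \<open>s = z = 0\<close> and the subsequence is empty.\<close>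

subsection \<open>Weights on digit vectors\<close>

lemma sum_lessThan_mult:
  fixes f :: "nat \<Rightarrow> 'a::comm_monoid_add"
  shows "(\<Sum>a<n * k. f a) = (\<Sum>c<n. \<Sum>a<k. f (c * k + a))"
proof -
  have "sum f {m * k..<m * k + k} = (\<Sum>a<k. f (m * k + a))" for m
    by (rule sum.reindex_bij_witness[of _ "\<lambda>a. m * k + a" "\<lambda>a. a - m * k"]) auto
  then show ?thesis by (simp flip: sum.nat_group)
qed

text \<open>A number below \<open>p ^ u\<close> encodes a vector of F_p^u by its
  base-\<open>p\<close> digits, so \<open>0\<close> is the zero vector. The dot product is left
  unreduced; reduction modulo \<open>p\<close> happens where it is used.\<close>

definition digit_dot :: "nat \<Rightarrow> nat \<Rightarrow> (nat \<Rightarrow> nat) \<Rightarrow> nat \<Rightarrow> nat" where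
  "digit_dot p u x a = (\<Sum>j<u. x j * (a div p ^ j mod p))"

lemma digit_dot_Suc:
  assumes "a < p ^ u" "c < p"
  shows "digit_dot p (Suc u) x (c * p ^ u + a) = digit_dot p u x a + x u * c"
proof -
  have "(c * p ^ u + a) div p ^ j mod p = a div p ^ j mod p" if "j < u" for j
  proof -
    \<comment> \<open>The factor \<open>p\<close> that remains after division by
      \<open>p ^ j\<close> hides the leading digit from position \<open>j < u\<close>.\<close>
    have "p ^ u = p ^ j * p * p ^ (u - Suc j)"
      using that by (simp flip: power_Suc power_add power_Suc2)
    then have "c * p ^ u + a = a + c * p * p ^ (u - Suc j) * p ^ j" by simp
    moreover have "p ^ j \<noteq> 0" using assms by (cases p) auto
    ultimately have "(c * p ^ u + a) div p ^ j = a div p ^ j + (c * p ^ (u - Suc j)) * p"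
      by (metis div_mult_self1 add.commute mult.assoc mult.commute)
    then show ?thesis by simp
  qed
  then show ?thesis using assms by (simp add: digit_dot_def)
qed

lemma digit_dot_eq_0: "(\<And>j. j < u \<Longrightarrow> x j = 0) \<Longrightarrow> digit_dot p u x a = 0"
  by (simp add: digit_dot_def)

text \<open>As \<open>x\<close> is invertible modulo \<open>p\<close>, the progression permutes the
  residues. Doubling avoids a division by 2.\<close>

lemma sum_mod_prime_progression:
  fixes p x s :: nat
  assumes "normalization_semidom_class.prime p" "0 < x" "x < p"
  shows "2 * (\<Sum>c<p. (s + x * c) mod p) = p * (p - 1)"
proof -
  have "\<not> p dvd x" using assms by (auto dest: dvd_imp_le)
  then have cop: "coprime x p" using assms prime_imp_coprime coprime_commute by blast
  have inj: "inj_on (\<lambda>c. (s + x * c) mod p) {..<p}"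
  proof (rule inj_onI)
    fix c d assume cd: "c \<in> {..<p}" "d \<in> {..<p}" and "(s + x * c) mod p = (s + x * d) mod p"
    then have "[x * c = x * d] (mod p)" by (simp flip: cong_def add: cong_add_lcancel_nat)
    then show "c = d" using cop cd cong_mult_lcancel_nat[of x p c d] by (simp add: cong_def)
  qed
  have "(\<lambda>c. (s + x * c) mod p) ` {..<p} = {..<p}"
    by (rule endo_inj_surj) (use inj assms in auto)
  then have "(\<Sum>c<p. (s + x * c) mod p) = \<Sum>{..<p}"
    using sum.reindex[OF inj, of "\<lambda>i. i"] by simp
  then show ?thesis using gauss_sum_nat[of "p - 1"] assms
    by (cases p) (auto simp: lessThan_Suc_atMost atLeast0AtMost)
qed

text \<open>A nonzero linear form on F_p^u takes every residue equally often. The shift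
  \<open>s\<close> is arbitrary so that the induction can absorb the contribution of the leading
  digit.\<close>

lemma sum_mod_prime_digit_dot:
  assumes "normalization_semidom_class.prime p" "\<And>j. j < u \<Longrightarrow> x j < p" "\<exists>j<u. x j \<noteq> 0"
  shows "2 * (\<Sum>a<p ^ u. (digit_dot p u x a + s) mod p) = p ^ u * (p - 1)"
  using assms(2,3)
proof (induction u arbitrary: s)
  case (Suc u)
  have split: "(\<Sum>a<p ^ Suc u. (digit_dot p (Suc u) x a + s) mod p)
      = (\<Sum>c<p. \<Sum>a<p ^ u. (digit_dot p u x a + (x u * c + s)) mod p)"
    by (simp add: sum_lessThan_mult digit_dot_Suc add.assoc)
  show ?case
  proof (cases "\<exists>j<u. x j \<noteq> 0")
    case True
    then have "2 * (\<Sum>a<p ^ u. (digit_dot p u x a + (x u * c + s)) mod p) = p ^ u * (p - 1)" for c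
      using Suc by simp
    then show ?thesis unfolding split by (subst sum_distrib_left) simp
  next
    case False
    then have "x u \<noteq> 0" using Suc.prems less_Suc_eq by auto
    then have *: "2 * (\<Sum>c<p. (s + x u * c) mod p) = p * (p - 1)"
      using sum_mod_prime_progression assms(1) Suc.prems by simp
    have "digit_dot p u x a = 0" for a using False by (intro digit_dot_eq_0) auto
    then have "(\<Sum>a<p ^ Suc u. (digit_dot p (Suc u) x a + s) mod p)
        = p ^ u * (\<Sum>c<p. (s + x u * c) mod p)"
      unfolding split by (simp add: add.commute sum_distrib_left)
    then show ?thesis using * by simp
  qed
qed simp

text \<open>The weights depend on the leading digit only: it is counted when it is \<open>1\<close> or \<open>-1\<close>, and
  the antipodal pair \<open>(x \<bullet> a) mod p + (- x \<bullet> a) mod p = p\<close> is what makes the total independent of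
  \<open>x\<close>.\<close>

lemma digit_weights_exist:
  assumes "normalization_semidom_class.prime (p::nat)"
  shows "\<exists>w. \<forall>x. (\<forall>j<u. x j < p) \<longrightarrow> (\<exists>j<u. x j \<noteq> 0) \<longrightarrow>
           (\<Sum>a<p ^ u. w a * (digit_dot p u x a mod p)) = p ^ u"
proof (induction u)
  case (Suc u)
  have p2: "p \<ge> 2" using assms prime_ge_2_nat by blast
  obtain w where w: "\<And>x. (\<forall>j<u. x j < p) \<Longrightarrow> (\<exists>j<u. x j \<noteq> 0) \<Longrightarrow>
           (\<Sum>a<p ^ u. w a * (digit_dot p u x a mod p)) = p ^ u"
    using Suc by blast
  \<comment> \<open>Leading digit \<open>0\<close> keeps the old weights. The two indicators are
    added, since for \<open>p = 2\<close> the digits \<open>1\<close> and \<open>p - 1\<close>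
    coincide and the weight has to be \<open>2\<close>.\<close>
  define w' :: "nat \<Rightarrow> nat" where "w' = (\<lambda>a. if a < p ^ u then w a
     else of_bool (a div p ^ u = 1) + of_bool (a div p ^ u = p - 1))"
  have pu: "p ^ u > 0" using p2 by simp
  have "(\<Sum>a<p ^ Suc u. w' a * (digit_dot p (Suc u) x a mod p)) = p ^ Suc u"
    if x: "\<forall>j<Suc u. x j < p" "\<exists>j<Suc u. x j \<noteq> 0" for x
  proof -
    define S where "S c = (\<Sum>a<p ^ u. (digit_dot p u x a + x u * c) mod p)" for c
    have inner: "(\<Sum>a<p ^ u. w' (c * p ^ u + a) * (digit_dot p (Suc u) x (c * p ^ u + a) mod p))
        = (if c = 0 then \<Sum>a<p ^ u. w a * (digit_dot p u x a mod p)
           else (of_bool (c = 1) + of_bool (c = p - 1)) * S c)" if c: "c < p" for c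
    proof (cases "c = 0")
      case True
      then show ?thesis using p2 by (simp add: w'_def digit_dot_Suc[of _ p u 0, simplified])
    next
      case False
      then have "w' (c * p ^ u + a) = of_bool (c = 1) + of_bool (c = p - 1)" if "a < p ^ u" for a
      proof -
        have "\<not> c * p ^ u + a < p ^ u" using False by (cases c) auto
        moreover have "(c * p ^ u + a) div p ^ u = c" using that pu by simp
        ultimately show ?thesis by (simp add: w'_def)
      qed
      then show ?thesis using c False
        by (simp add: S_def sum_distrib_left digit_dot_Suc)
    qed
    have "(\<Sum>c<p. if c = 0 then T else (of_bool (c = 1) + of_bool (c = p - 1)) * S c)
        = T + S 1 + S (p - 1)" for T
    proof -
      have "(\<Sum>c<p. if c = 0 then T else (of_bool (c = 1) + of_bool (c = p - 1)) * S c)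
        = (\<Sum>c<p. (if c = 0 then T else 0) + (if c = 1 then S 1 else 0) + (if c = p - 1 then S (p - 1) else 0))"
        using p2 by (intro sum.cong) auto
      then show ?thesis using p2 by (simp add: sum.distrib)
    qed
    then have total: "(\<Sum>a<p ^ Suc u. w' a * (digit_dot p (Suc u) x a mod p))
        = (\<Sum>a<p ^ u. w a * (digit_dot p u x a mod p)) + S 1 + S (p - 1)"
      by (simp add: sum_lessThan_mult inner)
    show ?thesis
    proof (cases "\<exists>j<u. x j \<noteq> 0")
      case True
      \<comment> \<open>The old part gives \<open>p ^ u\<close>; the slices at \<open>1\<close> and
        \<open>p - 1\<close> are each half of \<open>p ^ u * (p - 1)\<close> by
        equidistribution.\<close>
      then have "2 * S c = p ^ u * (p - 1)" for c
        unfolding S_def using x by (intro sum_mod_prime_digit_dot assms) auto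
      then have "2 * S 1 = p ^ u * (p - 1)" "2 * S (p - 1) = p ^ u * (p - 1)" by blast+
      then have "S 1 + S (p - 1) = p ^ u * (p - 1)" by linarith
      moreover have "(\<Sum>a<p ^ u. w a * (digit_dot p u x a mod p)) = p ^ u" using w x True by auto
      ultimately have "(\<Sum>a<p ^ Suc u. w' a * (digit_dot p (Suc u) x a mod p)) = p ^ u + p ^ u * (p - 1)"
        using total by linarith
      then show ?thesis using p2 by (cases p) auto
    next
      case False
      then have xu: "0 < x u" "x u < p" using x less_Suc_eq by auto
      have [simp]: "digit_dot p u x a = 0" for a using False by (intro digit_dot_eq_0) auto
      \<comment> \<open>Only the leading digit acts: the old part vanishes, and the summands of the
        two slices are constantly \<open>x u\<close> and \<open>p - x u\<close>.\<close>
      have "x u * (p - 1) = (p - x u) + p * (x u - 1)"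
        using xu by (cases "x u"; cases p) (auto simp: algebra_simps)
      then have "x u * (p - 1) mod p = (p - x u) mod p" by simp
      then have "x u * (p - 1) mod p = p - x u" using xu by simp
      then have "S 1 + S (p - 1) = p ^ u * x u + p ^ u * (p - x u)"
        using xu by (simp add: S_def)
      also have "\<dots> = p ^ Suc u" using xu by (simp flip: add_mult_distrib2)
      finally show ?thesis using total by simp
    qed
  qed
  then show ?case by blast
qed simp

subsection \<open>Zero-sum free families\<close>

definition mset_prod :: "('a, 'b) monoid_scheme \<Rightarrow> 'a multiset \<Rightarrow> 'a" where
  "mset_prod G S = finprod G (\<lambda>x. x [^]\<^bsub>G\<^esub> count S x) (set_mset S)"

context comm_group begin

lemma mset_prod_superset:
  assumes "finite A" "set_mset S \<subseteq> A" "A \<subseteq> carrier G"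
  shows "mset_prod G S = (\<Otimes>x\<in>A. x [^] count S x)"
  unfolding mset_prod_def
  by (rule finprod_mono_neutral_cong_left)
     (use assms in \<open>auto simp: not_in_iff\<close>)

lemma mset_prod_add:
  assumes "set_mset S \<subseteq> carrier G" "set_mset T \<subseteq> carrier G"
  shows "mset_prod G (S + T) = mset_prod G S \<otimes> mset_prod G T"
proof -
  let ?A = "set_mset S \<union> set_mset T"
  have A: "finite ?A" "?A \<subseteq> carrier G" using assms by auto
  have "mset_prod G (S + T) = (\<Otimes>x\<in>?A. x [^] count (S + T) x)"
    by (rule mset_prod_superset) (use A in auto)
  also have "\<dots> = (\<Otimes>x\<in>?A. x [^] count S x \<otimes> x [^] count T x)"
    by (rule finprod_cong') (use A in \<open>auto simp: nat_pow_mult\<close>)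
  also have "\<dots> = mset_prod G S \<otimes> mset_prod G T"
    using A by (subst finprod_multf) (auto simp: mset_prod_superset[of ?A])
  finally show ?thesis .
qed

lemma mset_prod_replicate:
  assumes "x \<in> carrier G"
  shows "mset_prod G (replicate_mset n x) = x [^] n"
  using assms by (subst mset_prod_superset[of "{x}"]) auto

text \<open>\<open>h\<close> may repeat values, whose multiplicities then merge in the multiset;
  inserting one index at a time avoids reindexing.\<close>

lemma mset_prod_sum_replicate:
  assumes "finite I" "\<And>i. i \<in> I \<Longrightarrow> h i \<in> carrier G"
  shows "mset_prod G (\<Sum>i\<in>I. replicate_mset (y i) (h i)) = (\<Otimes>i\<in>I. h i [^] (y i :: nat))"
  using assms
proof (induction I)
  case empty
  then show ?case by (simp add: mset_prod_def)
next
  case (insert i I)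
  have "set_mset (\<Sum>i\<in>I. replicate_mset (y i) (h i)) \<subseteq> carrier G"
    using insert by (auto simp: set_mset_sum)
  moreover have "set_mset (replicate_mset (y i) (h i)) \<subseteq> carrier G"
    using insert by auto
  ultimately have "mset_prod G (\<Sum>i\<in>insert i I. replicate_mset (y i) (h i)) =
      h i [^] y i \<otimes> (\<Otimes>i\<in>I. h i [^] y i)"
    using insert by (simp add: mset_prod_add mset_prod_replicate)
  moreover have "(\<Otimes>i\<in>insert i I. h i [^] y i) = h i [^] y i \<otimes> (\<Otimes>i\<in>I. h i [^] y i)"
    using insert by (intro finprod_insert) auto
  ultimately show ?case by simp
qed

end

text \<open>As \<open>h\<close> need not be injective, copies of a common value must be distributed
  among indices. This is done greedily: one index takes as many as its bound allows, the rest goes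
  to the others.\<close>

lemma subseteq_sum_replicate_msetE:
  assumes "finite I" "T \<subseteq># (\<Sum>i\<in>I. replicate_mset (c i) (h i))"
  obtains y where "\<And>i. i \<in> I \<Longrightarrow> y i \<le> c i" "T = (\<Sum>i\<in>I. replicate_mset (y i) (h i))"
  using assms
proof (induction I arbitrary: T thesis)
  case empty
  then show ?case by auto
next
  case (insert i I)
  let ?R = "replicate_mset (c i) (h i)"
  have "T - ?R \<subseteq># (\<Sum>i\<in>I. replicate_mset (c i) (h i))"
    using insert by (simp add: subset_eq_diff_conv add.commute)
  then obtain y where y: "\<And>i. i \<in> I \<Longrightarrow> y i \<le> c i" "T - ?R = (\<Sum>i\<in>I. replicate_mset (y i) (h i))"
    using insert.IH by blast
  have "T \<inter># ?R \<subseteq># ?R" by simp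
  then obtain m where m: "m \<le> c i" "T \<inter># ?R = replicate_mset m (h i)"
    using msubseteq_replicate_msetE by metis
  have "(\<Sum>k\<in>I. replicate_mset ((y(i := m)) k) (h k)) = T - ?R"
    unfolding y(2) using insert.hyps by (intro sum.cong) auto
  then have "(\<Sum>k\<in>insert i I. replicate_mset ((y(i := m)) k) (h k)) = T \<inter># ?R + (T - ?R)"
    using insert.hyps m(2) by simp
  also have "\<dots> = T" by (simp add: multiset_eq_iff)
  finally have "T = (\<Sum>k\<in>insert i I. replicate_mset ((y(i := m)) k) (h k))" by simp
  moreover have "(y(i := m)) k \<le> c k" if "k \<in> insert i I" for k
    using that y m by auto
  ultimately show ?case using insert.prems(1) by blast
qed

section \<open>Attainment of the Davenport constant and a criterion for lower bounds\<close>

context comm_group begin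

text \<open>The \<open>LEAST\<close> has its defining property once some \<open>d\<close> has it.
  The square of \<open>order G\<close> does: by pigeonhole some element occurs at least
  \<open>order G\<close> times, and that many copies of it are zero-sum.\<close>

lemma davenport_property:
  assumes "finite (carrier G)"
  shows "\<forall>S. set_mset S \<subseteq> carrier G \<and> size S \<ge> davenport G \<longrightarrow>
           (\<exists>T. T \<subseteq># S \<and> T \<noteq> {#} \<and> zero_sum G T)"
  unfolding davenport_def
proof (rule LeastI_ex, rule exI[of _ "order G * order G"], intro allI impI)
  fix S assume S: "set_mset S \<subseteq> carrier G \<and> size S \<ge> order G * order G"
  have pos: "order G > 0" using assms order_gt_0_iff_finite by simp
  have "\<exists>x\<in>set_mset S. count S x \<ge> order G"
  proof (rule ccontr)
    assume "\<not> ?thesis"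
    then have "count S x \<le> order G - 1" if "x \<in># S" for x using that by force
    then have "size S \<le> (\<Sum>x\<in>set_mset S. order G - 1)"
      unfolding size_multiset_overloaded_eq by (rule sum_mono)
    also have "\<dots> = card (set_mset S) * (order G - 1)" by simp
    also have "\<dots> \<le> order G * (order G - 1)"
      using S assms by (intro mult_right_mono) (auto simp: order_def intro: card_mono)
    also have "\<dots> < order G * order G" using pos by simp
    finally show False using S by simp
  qed
  then obtain x where x: "x \<in># S" "count S x \<ge> order G" by blast
  then have "x \<in> carrier G" using S by auto
  then have "zero_sum G (replicate_mset (order G) x)"
    using mset_prod_replicate[of x "order G"] pow_order_eq_1
    by (simp add: zero_sum_def mset_prod_def)
  moreover have "replicate_mset (order G) x \<subseteq># S" by (rule count_le_replicate_mset_subset_eq[THEN iffD1, OF x(2)])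
  ultimately show "\<exists>T. T \<subseteq># S \<and> T \<noteq> {#} \<and> zero_sum G T" using pos
    by (intro exI[of _ "replicate_mset (order G) x"]) auto
qed

text \<open>The multiplicities \<open>y\<close> bounded by \<open>c\<close> describe all
  subsequences, so the family is a zero-sum free sequence whose length is the sum of the
  \<open>c i\<close>.\<close>

lemma davenport_gt_zero_sum_free:
  fixes c :: "'i \<Rightarrow> nat"
  assumes "finite (carrier G)" "finite I" "\<And>i. i \<in> I \<Longrightarrow> h i \<in> carrier G"
    and free: "\<And>y. (\<And>i. i \<in> I \<Longrightarrow> y i \<le> c i) \<Longrightarrow> (\<Otimes>i\<in>I. h i [^] y i) = \<one> \<Longrightarrow> \<forall>i\<in>I. y i = 0"
  shows "davenport G > (\<Sum>i\<in>I. c i)"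
proof (rule ccontr)
  assume "\<not> ?thesis"
  let ?S = "\<Sum>i\<in>I. replicate_mset (c i) (h i)"
  have "size ?S = (\<Sum>i\<in>I. c i)" by simp
  moreover have "set_mset ?S \<subseteq> carrier G" using assms by (auto simp: set_mset_sum)
  ultimately obtain T where T: "T \<subseteq># ?S" "T \<noteq> {#}" "zero_sum G T"
    using davenport_property[OF assms(1)] \<open>\<not> _\<close> by (metis not_less)
  obtain y where y: "\<And>i. i \<in> I \<Longrightarrow> y i \<le> c i" "T = (\<Sum>i\<in>I. replicate_mset (y i) (h i))"
    using subseteq_sum_replicate_msetE[OF assms(2) T(1)] by blast
  then have "(\<Otimes>i\<in>I. h i [^] y i) = \<one>"
    using T assms mset_prod_sum_replicate[of I h y] by (simp add: zero_sum_def mset_prod_def)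
  then have "\<forall>i\<in>I. y i = 0" using free y by blast
  then show False using y T by simp
qed

end

subsection \<open>Uniqueness of invariant factors\<close>

text \<open>With \<open>g = gcd n d\<close>, the elements killed by \<open>d\<close> are the
  \<open>g\<close> multiples of \<open>n / g\<close>. Such counts are the invariant from which the
  invariant factors are recovered.\<close>

lemma card_torsion_integer_mod_group:
  assumes "n > 0"
  shows "card {x \<in> carrier (integer_mod_group n). x [^]\<^bsub>integer_mod_group n\<^esub> (d::nat) = \<one>\<^bsub>integer_mod_group n\<^esub>} = gcd n d"
proof -
  define g where "g = gcd n d"
  obtain n' d' where nd: "n = g * n'" "d = g * d'" "coprime n' d'"
    using assms gcd_coprime_exists[of n d] unfolding g_def by (metis gcd_eq_0_iff mult.commute not_gr_zero)
  have pos: "g > 0" "n' > 0" using nd assms by (auto intro: Nat.gr0I)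
  have dvd: "int n dvd int d * x \<longleftrightarrow> int n' dvd x" for x
  proof -
    have "int n dvd int d * x \<longleftrightarrow> int n' dvd int d' * x"
      using pos nd by (simp add: mult.assoc)
    also have "\<dots> \<longleftrightarrow> int n' dvd x"
      using nd(3) by (intro coprime_dvd_mult_right_iff) simp
    finally show ?thesis .
  qed
  have "bij_betw (\<lambda>y. int n' * int y) {..<g}
      {x \<in> carrier (integer_mod_group n). x [^]\<^bsub>integer_mod_group n\<^esub> d = \<one>\<^bsub>integer_mod_group n\<^esub>}"
    unfolding bij_betw_def
  proof
    show "inj_on (\<lambda>y. int n' * int y) {..<g}" using pos by (auto simp: inj_on_def)
    show "(\<lambda>y. int n' * int y) ` {..<g} = {x \<in> carrier (integer_mod_group n).
        x [^]\<^bsub>integer_mod_group n\<^esub> d = \<one>\<^bsub>integer_mod_group n\<^esub>}" (is "?L = ?R")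
    proof (intro equalityI subsetI)
      fix x assume "x \<in> ?L"
      then obtain y where y: "x = int n' * int y" "y < g" by auto
      then have "x < int n" using pos nd(1) by (simp add: mult.commute flip: of_nat_mult)
      then show "x \<in> ?R" using y assms dvd[of x] by (simp add: carrier_integer_mod_group mod_0_imp_dvd dvd_imp_mod_0)
    next
      fix x assume "x \<in> ?R"
      then have x: "0 \<le> x" "x < int n" "int n' dvd x"
        using assms dvd[of x] by (auto simp: carrier_integer_mod_group)
      then obtain y where y: "x = int n' * y" by blast
      then have "0 \<le> y" "y < int g" using x pos nd(1) by (auto simp: zero_le_mult_iff mult.commute)
      then show "x \<in> ?L" using y by (intro image_eqI[of _ _ "nat y"]) auto
    qed
  qed
  then show ?thesis using bij_betw_same_card g_def by fastforce
qed

lemma pow_product_group: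
  assumes "x \<in> carrier (product_group I H)"
  shows "x [^]\<^bsub>product_group I H\<^esub> (d::nat) = (\<lambda>i\<in>I. x i [^]\<^bsub>H i\<^esub> d)"
  by (induction d) (auto simp: fun_eq_iff)

lemma card_torsion_product_group:
  assumes "finite I"
  shows "card {x \<in> carrier (product_group I H). x [^]\<^bsub>product_group I H\<^esub> (d::nat) = \<one>\<^bsub>product_group I H\<^esub>}
    = (\<Prod>i\<in>I. card {x \<in> carrier (H i). x [^]\<^bsub>H i\<^esub> d = \<one>\<^bsub>H i\<^esub>})"
proof -
  have "{x \<in> carrier (product_group I H). x [^]\<^bsub>product_group I H\<^esub> d = \<one>\<^bsub>product_group I H\<^esub>}
    = (\<Pi>\<^sub>E i\<in>I. {x \<in> carrier (H i). x [^]\<^bsub>H i\<^esub> d = \<one>\<^bsub>H i\<^esub>})"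
    by (auto simp: pow_product_group PiE_iff fun_eq_iff restrict_def extensional_def)
  then show ?thesis using assms by (simp add: card_PiE)
qed

lemma iso_card_torsion_eq:
  assumes "G \<cong> H" "group G" "group H"
  shows "card {x \<in> carrier G. x [^]\<^bsub>G\<^esub> (d::nat) = \<one>\<^bsub>G\<^esub>} = card {x \<in> carrier H. x [^]\<^bsub>H\<^esub> d = \<one>\<^bsub>H\<^esub>}"
proof -
  obtain f where f: "f \<in> iso G H" using assms(1) by (auto simp: is_iso_def)
  then interpret group_hom G H f
    using assms by (simp add: group_hom_def group_hom_axioms_def iso_def)
  have inj: "inj_on f (carrier G)" and im: "f ` carrier G = carrier H"
    using f by (auto simp: iso_def bij_betw_def)
  have iff: "f x [^]\<^bsub>H\<^esub> d = \<one>\<^bsub>H\<^esub> \<longleftrightarrow> x [^]\<^bsub>G\<^esub> d = \<one>\<^bsub>G\<^esub>" if "x \<in> carrier G" for x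
    using that inj inj_onD[OF inj, of "x [^]\<^bsub>G\<^esub> d" "\<one>\<^bsub>G\<^esub>"] by (auto simp flip: hom_nat_pow)
  have image: "f ` {x \<in> carrier G. x [^]\<^bsub>G\<^esub> d = \<one>\<^bsub>G\<^esub>} = {x \<in> carrier H. x [^]\<^bsub>H\<^esub> d = \<one>\<^bsub>H\<^esub>}"
    using iff by (auto simp flip: im)
  have "inj_on f {x \<in> carrier G. x [^]\<^bsub>G\<^esub> d = \<one>\<^bsub>G\<^esub>}"
    using inj by (rule inj_on_subset) auto
  from card_image[OF this] show ?thesis unfolding image by (rule sym)
qed

text \<open>No \<open>gcd x d\<close> exceeds \<open>x\<close>, one is strictly smaller, and
  positivity preserves strictness in the product. Equality of the two products thus tests whether
  \<open>d\<close> is a common multiple of the list.\<close>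

lemma prod_list_gcd_less:
  fixes ns :: "nat list"
  assumes "\<forall>x\<in>set ns. 0 < x" "x \<in> set ns" "\<not> x dvd d"
  shows "(\<Prod>x\<leftarrow>ns. gcd x d) < prod_list ns"
  using assms(1,2)
proof (induction ns)
  case (Cons a ns)
  have le: "(\<Prod>x\<leftarrow>ns. gcd x d) \<le> prod_list ns" if "\<forall>x\<in>set ns. 0 < x" for ns :: "nat list"
    using that by (induction ns) (auto intro!: mult_le_mono)
  have pos: "0 < prod_list ns" if "\<forall>x\<in>set ns. 0 < x" for ns :: "nat list"
    using that by (induction ns) auto
  show ?case
  proof (cases "x = a")
    case True
    then have "gcd a d < a" using Cons.prems assms(3)
      by (metis gcd_dvd1 gcd_dvd2 dvd_imp_le le_neq_implies_less list.set_intros(1))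
    then have "gcd a d * (\<Prod>x\<leftarrow>ns. gcd x d) < a * prod_list ns"
      using le[of ns] pos[of ns] Cons.prems by (meson list.set_intros(2) le_less_trans mult_le_mono2 mult_less_cancel2)
    then show ?thesis by simp
  next
    case False
    then have "(\<Prod>x\<leftarrow>ns. gcd x d) < prod_list ns" using Cons by auto
    moreover have "gcd a d \<le> a" "0 < a" using Cons.prems by auto
    ultimately have "gcd a d * (\<Prod>x\<leftarrow>ns. gcd x d) < a * prod_list ns"
      by (intro mult_le_less_imp_less) auto
    then show ?thesis by simp
  qed
qed simp

text \<open>The last entry of a divisibility chain is a common multiple of all entries, so it is
  recovered first, by induction from the right. Taking it as \<open>d\<close> makes the product of
  its own list full; equality then forces the other last entry to divide it.\<close>

lemma prod_list_gcd_inject: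
  fixes ns ms :: "nat list"
  assumes "\<And>d. (\<Prod>x\<leftarrow>ns. gcd x d) = (\<Prod>x\<leftarrow>ms. gcd x d)"
    and "\<forall>x\<in>set ns. 1 < x" "\<forall>x\<in>set ms. 1 < x"
    and "successively (dvd) ns" "successively (dvd) ms"
  shows "ns = ms"
  using assms
proof (induction ns arbitrary: ms rule: rev_induct)
  case Nil
  \<comment> \<open>\<open>gcd x 0 = x\<close>, so \<open>d = 0\<close> yields the product of the
    whole list.\<close>
  then have "prod_list ms = 1" using Nil.prems(1)[of 0] by simp
  then show ?case using Nil.prems(3) by (cases ms) auto
next
  case (snoc a ns)
  have "prod_list (ns @ [a]) = prod_list ms" using snoc.prems(1)[of 0] by simp
  moreover have "1 < prod_list (ns @ [a])"
  proof -
    have "prod_list ns \<noteq> 0" using snoc.prems(2) by (auto simp: prod_list_zero_iff)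
    then show ?thesis using snoc.prems(2) by (cases "prod_list ns") auto
  qed
  ultimately have "ms \<noteq> []" by auto
  then obtain b ms' where ms: "ms = ms' @ [b]" by (metis rev_exhaust)
  have dvd_last: "x dvd b" if "successively (dvd) (xs @ [b])" "x \<in> set (xs @ [b])" for xs and x b :: nat
    using that by (auto simp: sorted_wrt_append successively_conv_sorted_wrt[OF transpI[OF dvd_trans]])
  have full: "(\<Prod>x\<leftarrow>xs. gcd x d) = prod_list xs" if "\<forall>x\<in>set xs. x dvd d" for xs and d :: nat
    using that by (induction xs) (auto simp: gcd_nat.absorb1)
  \<comment> \<open>Stated for arbitrary lists because it is applied in both directions.\<close>
  have dvd: "a dvd b" if "\<And>d. (\<Prod>x\<leftarrow>ns @ [a]. gcd x d) = (\<Prod>x\<leftarrow>ms @ [b]. gcd x d)"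
      "\<forall>x\<in>set (ns @ [a]). 1 < x" "successively (dvd) (ms @ [b])" for ns ms and a b :: nat
  proof (rule ccontr)
    assume "\<not> a dvd b"
    then have "(\<Prod>x\<leftarrow>ns @ [a]. gcd x b) < prod_list (ns @ [a])"
      using that(2) by (intro prod_list_gcd_less[of _ a]) auto
    moreover have "(\<Prod>x\<leftarrow>ms @ [b]. gcd x b) = prod_list (ms @ [b])"
      using that(3) dvd_last by (intro full) blast
    moreover have "prod_list (ns @ [a]) = prod_list (ms @ [b])" using that(1)[of 0] by simp
    ultimately show False using that(1)[of b] by simp
  qed
  have ab: "a = b"
    using dvd[of ns a ms' b] dvd[of ms' b ns a] snoc.prems unfolding ms
    by (intro dvd_antisym) metis+
  have "(\<Prod>x\<leftarrow>ns. gcd x d) = (\<Prod>x\<leftarrow>ms'. gcd x d)" for d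
    using snoc.prems(1)[of d] snoc.prems(2) unfolding ms ab by auto
  then have "ns = ms'"
    using snoc.prems unfolding ms by (intro snoc.IH) (auto simp: successively_append_iff)
  then show ?case using ms ab by simp
qed

text \<open>Both lists compute the same torsion counts of \<open>G\<close>, and these determine a
  divisibility chain. This is what makes the \<open>THE\<close> in \<open>davenport_star\<close>
  denote.\<close>

lemma invariant_factors_unique:
  assumes "group G" "invariant_factors G ns" "invariant_factors G ms"
  shows "ns = ms"
proof (rule prod_list_gcd_inject)
  have count: "card {x \<in> carrier G. x [^]\<^bsub>G\<^esub> d = \<one>\<^bsub>G\<^esub>} = (\<Prod>x\<leftarrow>ns. gcd x d)"
    if "invariant_factors G ns" for ns and d :: nat
  proof -
    let ?P = "product_group {..<length ns} (\<lambda>i. integer_mod_group (ns ! i))"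
    have "card {x \<in> carrier G. x [^]\<^bsub>G\<^esub> d = \<one>\<^bsub>G\<^esub>} = card {x \<in> carrier ?P. x [^]\<^bsub>?P\<^esub> d = \<one>\<^bsub>?P\<^esub>}"
      using that assms(1) by (intro iso_card_torsion_eq) (auto simp: invariant_factors_def)
    also have "\<dots> = (\<Prod>i<length ns. gcd (ns ! i) d)"
      unfolding card_torsion_product_group[OF finite_lessThan]
    proof (intro prod.cong refl card_torsion_integer_mod_group)
      fix i assume "i \<in> {..<length ns}"
      then have "ns ! i \<in> set ns" by simp
      then show "0 < ns ! i" using that unfolding invariant_factors_def by fastforce
    qed
    also have "\<dots> = (\<Prod>x\<leftarrow>ns. gcd x d)"
      by (simp add: prod.list_conv_set_nth atLeast0LessThan)
    finally show ?thesis .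
  qed
  show "(\<Prod>x\<leftarrow>ns. gcd x d) = (\<Prod>x\<leftarrow>ms. gcd x d)" for d
    using count[OF assms(2), of d] count[OF assms(3), of d] by simp
qed (use assms in \<open>auto simp: invariant_factors_def\<close>)

section \<open>The value of \<open>davenport_star\<close> on C_n^r + C_kn\<close>

lemma davenport_star_eq:
  assumes "group G" "invariant_factors G ns"
  shows "davenport_star G = 1 + (\<Sum>i<length ns. ns ! i - 1)"
  unfolding davenport_star_def using assms invariant_factors_unique by (intro the_equality) blast+

text \<open>\<open>H\<close> is any function extending \<open>A\<close> by \<open>B\<close> at index
  \<open>r\<close>, so that indexing into an appended list fits it.\<close>

lemma DirProd_product_group_iso:
  assumes "\<And>i. i < r \<Longrightarrow> H i = A i" "H r = B"
  shows "product_group {..<r} A \<times>\<times> B \<cong> product_group {..<Suc r} H"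
proof -
  let ?f = "\<lambda>(x, y). \<lambda>i\<in>{..<Suc r}. if i < r then x i else y"
  have "?f \<in> iso (product_group {..<r} A \<times>\<times> B) (product_group {..<Suc r} H)"
  proof (rule isoI)
    show "?f \<in> hom (product_group {..<r} A \<times>\<times> B) (product_group {..<Suc r} H)"
    proof (rule homI)
      fix a assume "a \<in> carrier (product_group {..<r} A \<times>\<times> B)"
      then show "?f a \<in> carrier (product_group {..<Suc r} H)"
        using assms by (cases a) (auto simp: PiE_iff less_Suc_eq)
    next
      fix a b
      show "?f (a \<otimes>\<^bsub>product_group {..<r} A \<times>\<times> B\<^esub> b) = ?f a \<otimes>\<^bsub>product_group {..<Suc r} H\<^esub> ?f b"
        using assms by (cases a; cases b) (auto intro!: restrict_ext simp: less_Suc_eq)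
    qed
    show "bij_betw ?f (carrier (product_group {..<r} A \<times>\<times> B)) (carrier (product_group {..<Suc r} H))"
    proof (rule bij_betw_byWitness[where f' = "\<lambda>x. (restrict x {..<r}, x r)"])
      show "\<forall>a\<in>carrier (product_group {..<r} A \<times>\<times> B). (restrict (?f a) {..<r}, ?f a r) = a"
      proof
        fix a assume "a \<in> carrier (product_group {..<r} A \<times>\<times> B)"
        then obtain x y where a: "a = (x, y)" "x \<in> extensional {..<r}" by (cases a) (simp add: PiE_def)
        have "restrict (?f (x, y)) {..<r} i = x i" for i
          using a(2) by (simp add: extensional_def restrict_def)
        then show "(restrict (?f a) {..<r}, ?f a r) = a" unfolding a(1) by (auto simp: fun_eq_iff)
      qed
      show "\<forall>a\<in>carrier (product_group {..<Suc r} H). ?f (restrict a {..<r}, a r) = a"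
      proof
        fix a assume "a \<in> carrier (product_group {..<Suc r} H)"
        then have "a \<in> extensional {..<Suc r}" by (simp add: PiE_iff)
        then show "?f (restrict a {..<r}, a r) = a"
          by (intro ext) (simp add: extensional_def restrict_def less_Suc_eq)
      qed
      show "?f ` carrier (product_group {..<r} A \<times>\<times> B) \<subseteq> carrier (product_group {..<Suc r} H)"
        using assms by (auto simp: PiE_iff less_Suc_eq)
      show "(\<lambda>x. (restrict x {..<r}, x r)) ` carrier (product_group {..<Suc r} H)
          \<subseteq> carrier (product_group {..<r} A \<times>\<times> B)"
      proof
        fix z assume "z \<in> (\<lambda>x. (restrict x {..<r}, x r)) ` carrier (product_group {..<Suc r} H)"
        then obtain x where x: "z = (restrict x {..<r}, x r)" "\<And>i. i < Suc r \<Longrightarrow> x i \<in> carrier (H i)"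
          by (auto simp: PiE_iff)
        then show "z \<in> carrier (product_group {..<r} A \<times>\<times> B)"
          using assms x(2)[of r] x(2)[OF less_SucI] by simp
      qed
    qed
  qed
  then show ?thesis by (auto simp: is_iso_def)
qed

lemma davenport_star_homocyclic_sum_cyclic:
  assumes "group G" "G \<cong> product_group {..<r} (\<lambda>_. integer_mod_group n) \<times>\<times> integer_mod_group (k * n)"
    and "n \<ge> 2" "k \<ge> 1"
  shows "davenport_star G = r * (n - 1) + k * n"
proof -
  let ?ns = "replicate r n @ [k * n]"
  have "product_group {..<r} (\<lambda>_. integer_mod_group n) \<times>\<times> integer_mod_group (k * n)
      \<cong> product_group {..<Suc r} (\<lambda>i. integer_mod_group (?ns ! i))"
    by (rule DirProd_product_group_iso) (auto simp: nth_append)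
  then have "G \<cong> product_group {..<length ?ns} (\<lambda>i. integer_mod_group (?ns ! i))"
    using assms(2) iso_trans by fastforce
  moreover have "successively (dvd) ?ns"
    by (auto simp: successively_conv_nth nth_append)
  moreover have "1 < k * n" using assms(3,4) by (metis One_nat_def Suc_1 Suc_le_lessD less_le_trans mult_le_mono nat_mult_1)
  ultimately have "invariant_factors G ?ns"
    using assms by (auto simp: invariant_factors_def)
  then have "davenport_star G = 1 + (\<Sum>i<length ?ns. ?ns ! i - 1)"
    using assms davenport_star_eq by blast
  also have "\<dots> = 1 + (\<Sum>i<Suc r. if i < r then n - 1 else k * n - 1)"
    by (auto intro!: sum.cong simp: nth_append)
  also have "\<dots> = r * (n - 1) + k * n" using assms \<open>1 < k * n\<close> by simp
  finally show ?thesis .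
qed

subsection \<open>A long zero-sum free sequence\<close>

text \<open>The arithmetic core. \<open>y a\<close>, \<open>x \<tau> j\<close> and \<open>z\<close>
  count the copies of the translate of \<open>e\<^sub>a\<close>, of \<open>g\<^sub>j\<close> in
  block \<open>\<tau>\<close>, and of \<open>f\<close>; \<open>coord\<close> and \<open>last\<close>
  say that the coordinates of the sum vanish. Index \<open>a\<close> carries vector
  \<open>Suc (a mod Q)\<close> of block \<open>a div Q\<close>, where \<open>Suc\<close> skips the
  zero vector.\<close>

lemma zero_sum_free_weights:
  fixes n p N M m k1 c t u r z :: nat and w y :: "nat \<Rightarrow> nat" and x :: "nat \<Rightarrow> nat \<Rightarrow> nat"
  defines "Q \<equiv> p ^ u - 1"
  assumes p: "normalization_semidom_class.prime p"
    and n: "n = p * N" "m = n * M" "m > 0"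
    and c: "[c * p ^ u = 1] (mod k1)"
    and t: "t < k1" "t * Q \<le> r"
    and w: "\<And>x. \<lbrakk>\<forall>j<u. x j < p; \<exists>j<u. x j \<noteq> 0\<rbrakk> \<Longrightarrow> (\<Sum>a<p ^ u. w a * (digit_dot p u x a mod p)) = p ^ u"
    and bounds: "\<And>a. a < r \<Longrightarrow> y a < n" "\<And>\<tau> j. \<lbrakk>\<tau> < t; j < u\<rbrakk> \<Longrightarrow> x \<tau> j < p" "z < (k1 - t) * m"
    and coord: "\<And>a. a < t * Q \<Longrightarrow> int n dvd int (y a) - int N * int (digit_dot p u (x (a div Q)) (Suc (a mod Q)))"
      "\<And>a. \<lbrakk>t * Q \<le> a; a < r\<rbrakk> \<Longrightarrow> n dvd y a"
    and last: "k1 * m dvd (\<Sum>a<t * Q. y a * (w (Suc (a mod Q)) * (p * M * c))) + z"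
  shows "(\<forall>a<r. y a = 0) \<and> (\<forall>\<tau><t. \<forall>j<u. x \<tau> j = 0) \<and> z = 0"
proof -
  have pu: "p ^ u = Suc Q" using prime_gt_0_nat[OF p] by (simp add: Q_def)
  define dot where "dot \<tau> a = digit_dot p u (x \<tau>) a" for \<tau> a
  \<comment> \<open>The coordinate fixes \<open>y a\<close> modulo \<open>n = p * N\<close>, and
    \<open>y a < n\<close> turns this into an equality.\<close>
  have y: "y a = N * (dot (a div Q) (Suc (a mod Q)) mod p)" if "a < t * Q" for a
  proof -
    have "int (y a) mod int n = int N * int (dot (a div Q) (Suc (a mod Q))) mod int n"
      using coord(1)[OF that] by (simp add: dot_def mod_eq_dvd_iff)
    then have "y a mod n = N * dot (a div Q) (Suc (a mod Q)) mod n"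
      by (metis of_nat_eq_iff of_nat_mod of_nat_mult)
    also have "\<dots> = N * (dot (a div Q) (Suc (a mod Q)) mod p)"
      unfolding n(1) mult.commute[of p] mult_mod_right ..
    finally show ?thesis using bounds(1)[of a] that t by simp
  qed
  define A where "A = {\<tau>. \<tau> < t \<and> (\<exists>j<u. x \<tau> j \<noteq> 0)}"
  have A: "finite A" "card A \<le> t"
    using card_mono[of "{..<t}" A] by (auto simp: A_def)
  have block: "(\<Sum>b<Q. w (Suc b) * (dot \<tau> (Suc b) mod p)) = (if \<tau> \<in> A then p ^ u else 0)" if "\<tau> < t" for \<tau>
  proof -
    \<comment> \<open>The zero vector adds nothing, so the sum over nonzero vectors can be completed
      to all \<open>p ^ u\<close>.\<close>
    have "dot \<tau> 0 = 0" by (simp add: dot_def digit_dot_def)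
    then have "(\<Sum>b<Q. w (Suc b) * (dot \<tau> (Suc b) mod p)) = (\<Sum>a<p ^ u. w a * (dot \<tau> a mod p))"
      unfolding pu sum.lessThan_Suc_shift by simp
    also have "\<dots> = (if \<tau> \<in> A then p ^ u else 0)"
    proof (cases "\<tau> \<in> A")
      case True
      then show ?thesis using w[of "x \<tau>"] bounds(2) that by (auto simp: A_def dot_def)
    next
      case False
      then have "dot \<tau> a = 0" for a using that by (auto simp: A_def dot_def intro!: digit_dot_eq_0)
      then show ?thesis using False by simp
    qed
    finally show ?thesis .
  qed
  \<comment> \<open>The factor \<open>p * M\<close> of the translation meets the factor
    \<open>N\<close> of \<open>y a\<close>, and \<open>N * p * M = m\<close>.\<close>
  have "(\<Sum>a<t * Q. y a * (w (Suc (a mod Q)) * (p * M * c)))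
      = (\<Sum>a<t * Q. m * c * (w (Suc (a mod Q)) * (dot (a div Q) (Suc (a mod Q)) mod p)))"
    by (rule sum.cong) (auto simp: y n(1,2))
  also have "\<dots> = m * c * (\<Sum>\<tau><t. \<Sum>b<Q. w (Suc b) * (dot \<tau> (Suc b) mod p))"
    unfolding sum_lessThan_mult sum_distrib_left by (intro sum.cong refl) auto
  also have "\<dots> = m * c * (\<Sum>\<tau><t. if \<tau> \<in> A then p ^ u else 0)"
    using block by simp
  also have "(\<Sum>\<tau><t. if \<tau> \<in> A then p ^ u else 0) = (\<Sum>\<tau>\<in>A. p ^ u)"
    by (rule sum.mono_neutral_cong_right) (auto simp: A_def)
  finally have "k1 * m dvd m * (c * p ^ u * card A) + z" using last by (simp add: mult_ac)
  \<comment> \<open>\<open>c\<close> inverts \<open>p ^ u\<close> modulo \<open>k1\<close>, so each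
    block in \<open>A\<close> contributes \<open>m\<close> modulo \<open>k1 * m\<close>.\<close>
  moreover have "[m * (c * p ^ u * card A) + z = m * card A + z] (mod k1 * m)"
  proof -
    have "[c * p ^ u * card A = 1 * card A] (mod k1)" using c by (rule cong_mult) simp
    then have "m * (c * p ^ u * card A) mod (m * k1) = m * card A mod (m * k1)"
      by (simp add: cong_def flip: mult_mod_right)
    then have "[m * (c * p ^ u * card A) = m * card A] (mod k1 * m)" by (simp add: cong_def mult.commute)
    then show ?thesis by (rule cong_add) simp
  qed
  ultimately have dvd: "k1 * m dvd m * card A + z" using cong_dvd_iff by blast
  \<comment> \<open>The bound on \<open>z\<close> leaves room for \<open>t\<close> blocks: the total
    stays below \<open>k1 * m\<close>, so divisibility forces it to be \<open>0\<close>.\<close>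
  have "m * card A + z < m * t + (k1 - t) * m"
    using A bounds(3) by (intro add_le_less_mono mult_le_mono2)
  also have "\<dots> = k1 * m" using t by (simp add: algebra_simps flip: add_mult_distrib)
  finally have "m * card A + z = 0" using dvd nat_dvd_not_less by blast
  then have z: "z = 0" and "A = {}" using n A by auto
  then have x: "\<forall>\<tau><t. \<forall>j<u. x \<tau> j = 0" by (auto simp: A_def)
  have "y a = 0" if "a < r" for a
  proof (cases "a < t * Q")
    case True
    then have "a div Q < t" using less_mult_imp_div_less by blast
    then have "dot (a div Q) (Suc (a mod Q)) = 0" using x by (simp add: dot_def digit_dot_eq_0)
    then show ?thesis using y True by simp
  next
    case False
    then show ?thesis using coord(2)[of a] bounds(1)[of a] that nat_dvd_not_less by force
  qed
  then show ?thesis using x z by blast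
qed

text \<open>\<open>E\<close> is a homomorphism from integer vectors with explicit kernel. It turns
  zero-sum conditions into divisibility over the integers, where the negative coefficients of the
  \<open>g\<^sub>j\<close> are harmless.\<close>

lemma cyclic_sum_coordinates:
  fixes G :: "('a, 'b) monoid_scheme"
  assumes "comm_group G" "G \<cong> product_group {..<r} (\<lambda>_. integer_mod_group n) \<times>\<times> integer_mod_group l"
    and pos: "n > 0" "l > 0"
  obtains E :: "(nat \<Rightarrow> int) \<Rightarrow> int \<Rightarrow> 'a" where "finite (carrier G)"
    "\<And>y z. E y z \<in> carrier G"
    "\<And>y y' z z'. E (\<lambda>i. y i + y' i) (z + z') = E y z \<otimes>\<^bsub>G\<^esub> E y' z'"
    "\<And>y z. E y z = \<one>\<^bsub>G\<^esub> \<longleftrightarrow> (\<forall>i<r. int n dvd y i) \<and> int l dvd z"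
proof -
  interpret G: comm_group G by fact
  let ?K = "product_group {..<r} (\<lambda>_. integer_mod_group n) \<times>\<times> integer_mod_group l"
  obtain f where f: "f \<in> iso ?K G"
    using assms(2) G.iso_sym by (auto simp: is_iso_def)
  interpret K: group ?K by (intro DirProd_group product_group group_integer_mod_group)
  interpret f: group_hom ?K G f
    using f by (simp add: group_hom_def group_hom_axioms_def iso_def)
  have bij: "bij_betw f (carrier ?K) (carrier G)" using f by (simp add: iso_def)
  define k where "k y z = (\<lambda>i\<in>{..<r}. y i mod int n, z mod int l)" for y :: "nat \<Rightarrow> int" and z
  have k: "k y z \<in> carrier ?K" for y z
    using pos by (simp add: k_def carrier_integer_mod_group)
  have k_add: "k (\<lambda>i. y i + y' i) (z + z') = k y z \<otimes>\<^bsub>?K\<^esub> k y' z'" for y y' z z'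
    by (auto simp: k_def mod_add_eq)
  have k_one: "k y z = \<one>\<^bsub>?K\<^esub> \<longleftrightarrow> (\<forall>i<r. int n dvd y i) \<and> int l dvd z" for y z
    by (auto simp: k_def fun_eq_iff restrict_def dvd_eq_mod_eq_0)
  show thesis
  proof (rule that[of "\<lambda>y z. f (k y z)"])
    have "finite (carrier ?K)"
      using pos by (auto simp: carrier_integer_mod_group intro!: finite_PiE)
    then show "finite (carrier G)" using bij bij_betw_finite by blast
    show "f (k y z) \<in> carrier G" for y z using k by simp
    show "f (k (\<lambda>i. y i + y' i) (z + z')) = f (k y z) \<otimes>\<^bsub>G\<^esub> f (k y' z')" for y y' z z'
      using k by (simp only: k_add f.hom_mult)
    show "f (k y z) = \<one>\<^bsub>G\<^esub> \<longleftrightarrow> (\<forall>i<r. int n dvd y i) \<and> int l dvd z" for y z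
      unfolding k_one[symmetric]
      using inj_onD[OF bij_betw_imp_inj_on[OF bij], of "k y z" "\<one>\<^bsub>?K\<^esub>"] k K.one_closed f.hom_one by metis
  qed
qed

lemma (in comm_group) finprod_additive_pow:
  fixes E :: "('j \<Rightarrow> int) \<Rightarrow> int \<Rightarrow> 'a" and c :: "'i \<Rightarrow> nat"
  assumes E: "\<And>y z. E y z \<in> carrier G"
    "\<And>y y' z z'. E (\<lambda>i. y i + y' i) (z + z') = E y z \<otimes> E y' z'"
    "E (\<lambda>_. 0) 0 = \<one>"
  assumes "finite I"
  shows "(\<Otimes>i\<in>I. E (Y i) (Z i) [^] c i) = E (\<lambda>j. \<Sum>i\<in>I. int (c i) * Y i j) (\<Sum>i\<in>I. int (c i) * Z i)"
  using assms(4)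
proof (induction I)
  case (insert i I)
  have pow: "E y z [^] d = E (\<lambda>j. int d * y j) (int d * z)" for y z and d :: nat
    using E(2)[of "\<lambda>j. int _ * y j" y "int _ * z" z]
    by (induction d) (auto simp: E(3) algebra_simps)
  have "(\<Otimes>k\<in>insert i I. E (Y k) (Z k) [^] c k) = E (Y i) (Z i) [^] c i \<otimes> (\<Otimes>k\<in>I. E (Y k) (Z k) [^] c k)"
    using insert E by (intro finprod_insert) auto
  also have "\<dots> = E (\<lambda>j. int (c i) * Y i j + (\<Sum>i\<in>I. int (c i) * Y i j)) (int (c i) * Z i + (\<Sum>i\<in>I. int (c i) * Z i))"
    unfolding E(2) insert.IH[symmetric] pow ..
  finally show ?case using insert.hyps by simp
qed (simp add: E)

text \<open>The summands count the translates, the copies of \<open>f\<close> and the copies of the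
  \<open>g\<^sub>j\<close>. Only \<open>(k1 - t) * m - 1\<close> copies of \<open>f\<close> are
  taken; the strict inequality for zero-sum free families restores the \<open>1\<close>.\<close>

lemma davenport_lower_bound:
  fixes G :: "('a, 'b) monoid_scheme" (structure)
  assumes G: "comm_group G"
    "G \<cong> product_group {..<r} (\<lambda>_. integer_mod_group n) \<times>\<times> integer_mod_group (k1 * m)"
    and p: "normalization_semidom_class.prime p" "p dvd n" "coprime p k1"
    and m: "n dvd m" "m > 0" and t: "t < k1" "t * (p ^ u - 1) \<le> r"
  shows "r * (n - 1) + (k1 - t) * m + t * u * (p - 1) \<le> davenport G"
proof -
  interpret comm_group G by fact
  obtain N M where NM: "n = p * N" "m = n * M" using p m by (auto simp: dvd_def)
  have n: "n > 0" using NM m by (auto intro: Nat.gr0I)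
  define Q where "Q = p ^ u - 1"
  obtain w where w: "\<And>x. \<lbrakk>\<forall>j<u. x j < p; \<exists>j<u. x j \<noteq> 0\<rbrakk> \<Longrightarrow> (\<Sum>a<p ^ u. w a * (digit_dot p u x a mod p)) = p ^ u"
    using digit_weights_exist[OF p(1)] by blast
  obtain c where c: "[c * p ^ u = 1] (mod k1)"
    using cong_solve_coprime_nat[of "p ^ u" k1] p(3) by (auto simp: mult.commute)
  have "n > 0" "k1 * m > 0" using n m t by auto
  from cyclic_sum_coordinates[OF G this]
  obtain E :: "(nat \<Rightarrow> int) \<Rightarrow> int \<Rightarrow> 'a" where fin: "finite (carrier G)"
    and E: "\<And>y z. E y z \<in> carrier G"
      "\<And>y y' z z'. E (\<lambda>i. y i + y' i) (z + z') = E y z \<otimes> E y' z'"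
      "\<And>y z. E y z = \<one> \<longleftrightarrow> (\<forall>i<r. int n dvd y i) \<and> int (k1 * m) dvd z"
    by blast
  \<comment> \<open>Tags for the translates, the \<open>g\<^sub>j\<close> of each block, and
    \<open>f\<close>, so that coinciding group elements remain separate terms.\<close>
  define I :: "(nat + nat \<times> nat + unit) set" where "I = {..<r} <+> ({..<t} \<times> {..<u} <+> {()})"
  define mult :: "nat + nat \<times> nat + unit \<Rightarrow> nat" where
    "mult = case_sum (\<lambda>_. n - 1) (case_sum (\<lambda>_. p - 1) (\<lambda>_. (k1 - t) * m - 1))"
  \<comment> \<open>\<open>Y\<close> holds the coordinates along the \<open>e\<^sub>a\<close>, with
    \<open>N = n / p\<close>, and \<open>Z\<close> the one along \<open>f\<close>.\<close>
  define Y :: "nat + nat \<times> nat + unit \<Rightarrow> nat \<Rightarrow> int" where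
    "Y = case_sum (\<lambda>a b. of_bool (b = a)) (case_sum (\<lambda>(\<tau>, j) b. if b < t * Q \<and> b div Q = \<tau>
       then - int (N * (Suc (b mod Q) div p ^ j mod p)) else 0) (\<lambda>_ _. 0))"
  define Z :: "nat + nat \<times> nat + unit \<Rightarrow> int" where
    "Z = case_sum (\<lambda>a. if a < t * Q then int (w (Suc (a mod Q)) * (p * M * c)) else 0)
       (case_sum (\<lambda>_. 0) (\<lambda>_. 1))"
  have finI: "finite I" by (simp add: I_def)
  have sumI: "(\<Sum>i\<in>I. f i) = (\<Sum>a<r. f (Inl a)) + (\<Sum>\<tau><t. \<Sum>j<u. f (Inr (Inl (\<tau>, j)))) + f (Inr (Inr ()))"
    for f :: "_ \<Rightarrow> 's::comm_monoid_add"
    by (simp add: I_def sum.Plus sum.cartesian_product add.assoc)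
  have "(\<Sum>i\<in>I. mult i) < davenport G"
  proof (rule davenport_gt_zero_sum_free[where h = "\<lambda>i. E (Y i) (Z i)"])
    fix y assume bound: "\<And>i. i \<in> I \<Longrightarrow> y i \<le> mult i" and one: "(\<Otimes>i\<in>I. E (Y i) (Z i) [^] y i) = \<one>"
    have "E (\<lambda>_. 0) 0 = \<one>" by (simp add: E)
    then have "(\<Otimes>i\<in>I. E (Y i) (Z i) [^] y i)
        = E (\<lambda>j. \<Sum>i\<in>I. int (y i) * Y i j) (\<Sum>i\<in>I. int (y i) * Z i)"
      by (intro finprod_additive_pow E(1,2) finI)
    with one have dvd: "\<And>a. a < r \<Longrightarrow> int n dvd (\<Sum>i\<in>I. int (y i) * Y i a)"
      and last: "int (k1 * m) dvd (\<Sum>i\<in>I. int (y i) * Z i)"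
      using E(3) by auto
    define x where "x \<tau> j = y (Inr (Inl (\<tau>, j)))" for \<tau> j
    have coord: "(\<Sum>i\<in>I. int (y i) * Y i a) = int (y (Inl a)) -
        (if a < t * Q then int N * int (digit_dot p u (x (a div Q)) (Suc (a mod Q))) else 0)" if "a < r" for a
    proof -
      have "(\<Sum>j<u. int (y (Inr (Inl (\<tau>, j)))) * Y (Inr (Inl (\<tau>, j))) a) =
        (if \<tau> = a div Q then if a < t * Q then - (int N * int (digit_dot p u (x (a div Q)) (Suc (a mod Q)))) else 0 else 0)" for \<tau>
        by (auto simp: Y_def x_def digit_dot_def sum_distrib_left mult_ac simp flip: sum_negf)
      moreover have "a div Q < t" if "a < t * Q" using that less_mult_imp_div_less by blast
      moreover have "(\<Sum>b<r. int (y (Inl b)) * Y (Inl b) a) = int (y (Inl a))"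
        using that by (simp add: Y_def of_bool_def if_distrib cong: if_cong)
      moreover have "Y (Inr (Inr ())) a = 0" by (simp add: Y_def)
      ultimately show ?thesis by (simp add: sumI)
    qed
    have lastZ: "(\<Sum>i\<in>I. int (y i) * Z i) = int ((\<Sum>a<t * Q. y (Inl a) * (w (Suc (a mod Q)) * (p * M * c))) + y (Inr (Inr ())))"
    proof -
      \<comment> \<open>Indices outside the \<open>t\<close> blocks are not translated, so the sum
        stops at \<open>t * Q\<close>.\<close>
      have "(\<Sum>a<r. int (y (Inl a)) * Z (Inl a)) = (\<Sum>a<t * Q. int (y (Inl a) * (w (Suc (a mod Q)) * (p * M * c))))"
        using t by (intro sum.mono_neutral_cong_right) (auto simp: Z_def Q_def)
      then show ?thesis by (simp add: sumI) (simp add: Z_def)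
    qed
    have "(\<forall>a<r. y (Inl a) = 0) \<and> (\<forall>\<tau><t. \<forall>j<u. x \<tau> j = 0) \<and> y (Inr (Inr ())) = 0"
    proof (rule zero_sum_free_weights[OF p(1) NM m(2) c t w])
      show "y (Inl a) < n" if "a < r" for a
      proof -
        have "y (Inl a) \<le> mult (Inl a)" using that by (intro bound) (auto simp: I_def)
        then show ?thesis using n by (simp add: mult_def)
      qed
      show "x \<tau> j < p" if "\<tau> < t" "j < u" for \<tau> j
      proof -
        have "x \<tau> j \<le> mult (Inr (Inl (\<tau>, j)))"
          unfolding x_def using that by (intro bound) (auto simp: I_def)
        then show ?thesis using prime_gt_0_nat[OF p(1)] by (simp add: mult_def)
      qed
      have "(k1 - t) * m > 0" using t m by simp
      moreover have "y (Inr (Inr ())) \<le> mult (Inr (Inr ()))" by (intro bound) (auto simp: I_def)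
      ultimately show "y (Inr (Inr ())) < (k1 - t) * m" by (simp add: mult_def del: nat_0_less_mult_iff)
    next
      fix a assume a: "a < t * (p ^ u - 1)"
      then show "int n dvd int (y (Inl a)) - int N * int (digit_dot p u (x (a div (p ^ u - 1))) (Suc (a mod (p ^ u - 1))))"
        using dvd[of a] coord[of a] t by (simp add: Q_def)
    next
      fix a assume "t * (p ^ u - 1) \<le> a" "a < r"
      then show "n dvd y (Inl a)" using dvd[of a] coord[of a] by (simp add: Q_def)
    next
      show "k1 * m dvd (\<Sum>a<t * (p ^ u - 1). y (Inl a) * (w (Suc (a mod (p ^ u - 1))) * (p * M * c))) + y (Inr (Inr ()))"
        using last unfolding lastZ Q_def of_nat_dvd_iff .
    qed
    then show "\<forall>i\<in>I. y i = 0" by (auto simp: I_def x_def)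
  qed (use fin finI E in auto)
  moreover have "(k1 - t) * m > 0" using t m by simp
  ultimately show ?thesis by (simp add: sumI mult_def)
qed

section \<open>The logarithmic form of the bound\<close>

theorem corollary4p4:
  fixes G :: "('a, 'b) monoid_scheme"
    and r n k p k1 m t :: nat
  assumes "comm_group G"
    and "G \<cong> product_group {..<r} (\<lambda>_. integer_mod_group n) \<times>\<times> integer_mod_group (k * n)"
    and "r \<ge> 1" and "n \<ge> 2" and "k \<ge> 2"
    and "\<not> primepow (Coset.order G)"
    and "normalization_semidom_class.prime p" and "p dvd n"
    and "k1 \<ge> 2" and "k1 dvd k" and "gcd p k1 = 1"
    and "k * n = k1 * m"
    and "t \<in> {1..k1 - 1}"
  shows "real (davenport G) >
           real (davenport_star G)
             + (real t * (real p - 1) / ln (real p)) * ln (real r)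
             - real t * (real p - 1) * (log (real p) (real t) + 1)
             - real t * real m"
proof -
  have star: "davenport_star G = r * (n - 1) + k1 * m"
    using davenport_star_homocyclic_sum_cyclic[of G r n k] assms by (simp add: comm_group_def)
  have p: "p > 1" using assms prime_gt_1_nat by blast
  have t: "0 < t" "t < k1" using assms by auto
  have m: "n dvd m" "m > 0"
  proof -
    obtain l where "k = k1 * l" using assms by blast
    then show "n dvd m" using assms by auto
    show "m > 0" using assms by (auto intro: Nat.gr0I)
  qed
  \<comment> \<open>For \<open>t \<le> r\<close>, \<open>u\<close> is the largest exponent with
    \<open>t * p ^ u \<le> r\<close>; for \<open>r < t\<close> the value \<open>q\<close> is
    negative and \<open>nat\<close> gives \<open>0\<close>. Either way \<open>q < u + 1\<close>, the
    source of the strict inequality.\<close>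
  define q where "q = log p r - log p t"
  define u where "u = nat \<lfloor>q\<rfloor>"
  have u: "q < real u + 1" unfolding u_def by linarith
  have "t * (p ^ u - 1) \<le> r"
  \<comment> \<open>A block uses only \<open>p ^ u - 1\<close> indices, hence none for
    \<open>u = 0\<close>, which settles the case \<open>r < t\<close>.\<close>
  proof (cases "u = 0")
    case False
    then have "real u \<le> q" unfolding u_def by linarith
    then have "log p (t * p ^ u) \<le> log p r"
      using p t by (simp add: q_def log_mult log_nat_power)
    then have "real (t * p ^ u) \<le> real r"
      using p t assms by (subst (asm) log_le_cancel_iff) auto
    then have "t * p ^ u \<le> r" by (simp only: of_nat_le_iff)
    then show ?thesis by (meson diff_le_self le_trans mult_le_mono2)
  qed simp
  then have "r * (n - 1) + (k1 - t) * m + t * u * (p - 1) \<le> davenport G"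
    using assms m t by (intro davenport_lower_bound) (auto simp: coprime_iff_gcd_eq_1)
  \<comment> \<open>The \<open>t * m\<close> copies of \<open>f\<close> given up for the blocks are
    the loss \<open>t m\<close> in the bound.\<close>
  moreover have "(k1 - t) * m + t * m = k1 * m" using t by (simp flip: add_mult_distrib)
  ultimately have "davenport_star G + t * u * (p - 1) \<le> davenport G + t * m" using star by linarith
  then have "real (davenport_star G) + real t * real u * real (p - 1) \<le> real (davenport G) + real t * real m"
    unfolding of_nat_mult[symmetric] of_nat_add[symmetric] of_nat_le_iff .
  moreover have "real t * (real p - 1) * (q - 1) < real t * (real p - 1) * real u"
    using u t p by (intro mult_strict_left_mono) auto
  moreover have "real t * (real p - 1) * (q - 1) = (real t * (real p - 1) / ln (real p)) * ln (real r)
             - real t * (real p - 1) * (log (real p) (real t) + 1)"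
    by (simp add: q_def log_def[of "real p" "real r"] right_diff_distrib distrib_left)
  ultimately show ?thesis using p by (simp add: of_nat_diff mult_ac)
qed

end
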